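(* Let $B$ be a non-necessarily bipartite bubble in dimension $D$ and let $$\alpha^M_B=\sup_{G\in\tilde{\mathbb{G}}(B)}\frac{\Phi_0(G)-D}{b(G)}.$$ For $\tilde a\in\mathbb{R}$ put $\delta_{\tilde a}(G)=D+\tilde a\,b(G)-\Phi_0(G)$ for $G\in\tilde{\mathbb{G}}(B)$. (1) The only possible choice of $\tilde a$ which might lead to a non-trivial and non-negative rational bubble-dependent degree $\delta_{\tilde a}$ is $\tilde a=\alpha^M_B$. (2) If the supremum $\alpha^M_B$ is reached (i.e. if it is a maximum), then the choice $\tilde a=\alpha^M_B$ indeed leads to a non-trivial and non-negative rational bubble-dependent degree $$\delta_B(G)=D+\alpha^M_B\,b(G)-\Phi_0(G)\in\mathbb{Q}^+\qquad(G\in\tilde{\mathbb{G}}(B)),$$ with infinitely many solutions $G\in\tilde{\mathbb{G}}(B)$ to $D+\alpha^M_B\,b(G)-\Phi_0(G)=0$. In particular, the leading order is the order $0$, and $N^D$ is always the right way of rescaling the free energy to extract the contributions to the leading order (i.e. the leading-order contributions are those surviving in $\frac{1}{N^D}F_B(\lambda,N)$ when $N\to\infty$).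
   Context: A bubble here is a finite connected $D$-regular graph (multiple edges allowed), properly edge-colored with colors $1,\dots,D$ (one edge of each color at each vertex), not necessarily bipartite. $\tilde{\mathbb{G}}(B)$ is the set of finite connected $(D+1)$-regular graphs, properly edge-colored with colors $0,1,\dots,D$, not necessarily bipartite, such that every connected component left after deleting all color-$0$ edges is a copy of $B$. For such $G$, $b(G)$ is the number of these components, and the $0$-score is $\Phi_0(G)=\sum_{i=1}^D\Phi_{0,i}(G)$, where $\Phi_{0,i}(G)$ is the number of cycles of $G$ alternating edges of colors $0$ and $i$. The degree $\delta_{\tilde a}$ is non-negative rational if it takes values in $\mathbb{Q}^+=\mathbb{Q}_{\ge 0}$; it is non-trivial if there is some $k$ such that $\delta_{\tilde a}(G)=k$ for infinitely many $G\in\tilde{\mathbb{G}}(B)$. The contributions of order $k$ are the graphs $G$ with $\delta_B(G)=k$, and the leading order is the first non-empty order. The free energy is the formal sum over connected graphs $F_B(\lambda,N)=N^D\sum_{G\in\tilde{\mathbb{G}}(B)}c(G)\,\lambda^{b(G)}N^{-\delta_B(G)}$, with $c(G)$ a non-zero numerical (symmetry) factor and $\lambda$ the counting parameter, so that $\frac{1}{N^D}F_B(\lambda,N)$ is an expansion in powers of $1/N$ whose term of order $k$ is the generating function of the graphs of order $k$. *)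

theory Defs
  imports Complex_Main "HOL-Computational_Algebra.Formal_Power_Series"
begin

(* An edge is a colour together with its set of endpoints.  Two vertices may be joined by
   several edges of different colours; several edges of the same colour between the same two
   vertices are excluded by proper colouring, so this representation loses no graph. *)
record 'v cgraph =
  verts :: "'v set"
  edges :: "(nat \<times> 'v set) set"

(* Finite, without loops, and with exactly one edge of each colour of C at each vertex;
   in particular |C|-regular and properly edge-coloured. *)
definition regular_coloured :: "nat set \<Rightarrow> 'v cgraph \<Rightarrow> bool" where
  "regular_coloured C G \<longleftrightarrow>
     finite (verts G) \<and>
     (\<forall>(c, e) \<in> edges G. c \<in> C \<and> e \<subseteq> verts G \<and> card e = 2) \<and>
     (\<forall>v \<in> verts G. \<forall>c \<in> C. \<exists>!e. (c, e) \<in> edges G \<and> v \<in> e)"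

definition adj :: "'v cgraph \<Rightarrow> 'v \<Rightarrow> 'v \<Rightarrow> bool" where
  "adj G u v \<longleftrightarrow> (\<exists>c. (c, {u, v}) \<in> edges G)"

definition connected_graph :: "'v cgraph \<Rightarrow> bool" where
  "connected_graph G \<longleftrightarrow>
     verts G \<noteq> {} \<and> (\<forall>u \<in> verts G. \<forall>v \<in> verts G. (adj G)\<^sup>*\<^sup>* u v)"

definition component_of :: "'v cgraph \<Rightarrow> 'v \<Rightarrow> 'v cgraph" where
  "component_of G v =
     \<lparr>verts = {w. (adj G)\<^sup>*\<^sup>* v w}, edges = {(c, e) \<in> edges G. e \<subseteq> {w. (adj G)\<^sup>*\<^sup>* v w}}\<rparr>"

definition components :: "'v cgraph \<Rightarrow> 'v cgraph set" where
  "components G = component_of G ` verts G"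

definition delete_colour :: "nat \<Rightarrow> 'v cgraph \<Rightarrow> 'v cgraph" where
  "delete_colour c G = \<lparr>verts = verts G, edges = {(c', e) \<in> edges G. c' \<noteq> c}\<rparr>"

definition isomorphic :: "'u cgraph \<Rightarrow> 'v cgraph \<Rightarrow> bool" where
  "isomorphic G H \<longleftrightarrow>
     (\<exists>f. bij_betw f (verts G) (verts H) \<and> edges H = (\<lambda>(c, e). (c, f ` e)) ` edges G)"

(* No bipartiteness is required. *)
definition bubble :: "nat \<Rightarrow> 'v cgraph \<Rightarrow> bool" where
  "bubble D B \<longleftrightarrow> regular_coloured {1..D} B \<and> connected_graph B"

definition labelled_graphs :: "nat \<Rightarrow> 'v cgraph \<Rightarrow> nat cgraph set" where
  "labelled_graphs D B =
     {G. regular_coloured {0..D} G \<and> connected_graph G \<and>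
         (\<forall>H \<in> components (delete_colour 0 G). isomorphic H B)}"

(* Graphs are counted up to (colour-preserving) isomorphism: tildeG contains exactly one
   representative of each isomorphism class.  Natural numbers as vertices suffice because
   the graphs are finite; see tildeG_representative below. *)
definition tildeG :: "nat \<Rightarrow> 'v cgraph \<Rightarrow> nat cgraph set" where
  "tildeG D B =
     (\<lambda>X. SOME G. G \<in> X) `
       (labelled_graphs D B //
          {(G, H). G \<in> labelled_graphs D B \<and> H \<in> labelled_graphs D B \<and> isomorphic G H})"

definition num_bubbles :: "'v cgraph \<Rightarrow> nat" where
  "num_bubbles G = card (components (delete_colour 0 G))"

(* C is the edge set of a cycle x 0, x 1, ..., x (2k-1) with pairwise distinct vertices whose
   edges have colours i, j, i, j, ...; for k = 1 it consists of two parallel edges. *)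
definition alternating_cycle :: "nat \<Rightarrow> nat \<Rightarrow> 'v cgraph \<Rightarrow> (nat \<times> 'v set) set \<Rightarrow> bool" where
  "alternating_cycle i j G C \<longleftrightarrow> C \<subseteq> edges G \<and>
     (\<exists>(k::nat) x. 0 < k \<and> inj_on x {..<2 * k} \<and>
        C = (\<Union>m<k. {(i, {x (2 * m), x (2 * m + 1)}),
                     (j, {x (2 * m + 1), x ((2 * m + 2) mod (2 * k))})}))"

definition Phi0i :: "nat \<Rightarrow> 'v cgraph \<Rightarrow> nat" where
  "Phi0i i G = card {C. alternating_cycle 0 i G C}"

definition Phi0 :: "nat \<Rightarrow> 'v cgraph \<Rightarrow> nat" where
  "Phi0 D G = (\<Sum>i=1..D. Phi0i i G)"

(* A supremum of a nonempty set that is bounded above, see tildeG_nonempty and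
   bdd_above_alphaM below. *)
definition alphaM :: "nat \<Rightarrow> 'v cgraph \<Rightarrow> real" where
  "alphaM D B = (SUP G\<in>tildeG D B. (real (Phi0 D G) - real D) / real (num_bubbles G))"

definition delta :: "nat \<Rightarrow> real \<Rightarrow> nat cgraph \<Rightarrow> real" where
  "delta D a G = real D + a * real (num_bubbles G) - real (Phi0 D G)"

definition nonneg_rational :: "nat \<Rightarrow> 'v cgraph \<Rightarrow> real \<Rightarrow> bool" where
  "nonneg_rational D B a \<longleftrightarrow> (\<forall>G \<in> tildeG D B. delta D a G \<in> \<rat> \<and> 0 \<le> delta D a G)"

definition order_contributions :: "nat \<Rightarrow> 'v cgraph \<Rightarrow> real \<Rightarrow> real \<Rightarrow> nat cgraph set" where
  "order_contributions D B a k = {G \<in> tildeG D B. delta D a G = k}"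

definition nontrivial :: "nat \<Rightarrow> 'v cgraph \<Rightarrow> real \<Rightarrow> bool" where
  "nontrivial D B a \<longleftrightarrow> (\<exists>k. infinite (order_contributions D B a k))"

definition leading_order :: "nat \<Rightarrow> 'v cgraph \<Rightarrow> real \<Rightarrow> real \<Rightarrow> bool" where
  "leading_order D B a k \<longleftrightarrow>
     order_contributions D B a k \<noteq> {} \<and> (\<forall>k'<k. order_contributions D B a k' = {})"

(* The contribution of G to the coefficient of lambda^(num_bubbles G) in the free energy. *)
definition contribution ::
  "nat \<Rightarrow> 'v cgraph \<Rightarrow> (nat cgraph \<Rightarrow> real) \<Rightarrow> real \<Rightarrow> nat cgraph \<Rightarrow> real" where
  "contribution D B c N G = N ^ D * (c G * N powr (- delta D (alphaM D B) G))"

(* The free energy as a formal power series in lambda.  Only finitely many graphs contribute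
   to each coefficient, see finite_num_bubbles below. *)
definition free_energy ::
  "nat \<Rightarrow> 'v cgraph \<Rightarrow> (nat cgraph \<Rightarrow> real) \<Rightarrow> real \<Rightarrow> real fps" where
  "free_energy D B c N =
     Abs_fps (\<lambda>n. \<Sum>G | G \<in> tildeG D B \<and> num_bubbles G = n. contribution D B c N G)"

definition order_series ::
  "nat \<Rightarrow> 'v cgraph \<Rightarrow> (nat cgraph \<Rightarrow> real) \<Rightarrow> real \<Rightarrow> real fps" where
  "order_series D B c k =
     Abs_fps (\<lambda>n. \<Sum>G | G \<in> order_contributions D B (alphaM D B) k \<and> num_bubbles G = n. c G)"

lemma isomorphic_refl: "isomorphic G G"
  unfolding isomorphic_def by (rule exI[of _ id]) (auto simp: case_prod_unfold)

lemma isomorphic_sym: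
  assumes "isomorphic G H" and "\<forall>(c, e) \<in> edges G. e \<subseteq> verts G"
  shows "isomorphic H G"
proof -
  obtain f where f: "bij_betw f (verts G) (verts H)"
    and E: "edges H = (\<lambda>(c, e). (c, f ` e)) ` edges G"
    using assms(1) unfolding isomorphic_def by blast
  let ?g = "inv_into (verts G) f"
  have 1: "bij_betw ?g (verts H) (verts G)" using f by (rule bij_betw_inv_into)
  have 2: "?g ` f ` e = e" if "(c, e) \<in> edges G" for c e
    using that assms(2) f unfolding bij_betw_def by (force intro: inv_into_image_cancel)
  have "(\<lambda>(c, e). (c, ?g ` e)) ` edges H = (\<lambda>(c, e). (c, ?g ` f ` e)) ` edges G"
    by (subst E, subst image_image, simp only: case_prod_unfold fst_conv snd_conv)
  also have "\<dots> = id ` edges G"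
    by (intro image_cong refl, simp only: split_paired_all prod.case id_apply 2)
  finally show ?thesis unfolding isomorphic_def using 1 by (intro exI[of _ ?g]) auto
qed

lemma isomorphic_trans:
  assumes "isomorphic G H" "isomorphic H K"
  shows "isomorphic G K"
proof -
  obtain f where f: "bij_betw f (verts G) (verts H)" "edges H = (\<lambda>(c, e). (c, f ` e)) ` edges G"
    using assms(1) unfolding isomorphic_def by blast
  obtain g where g: "bij_betw g (verts H) (verts K)" "edges K = (\<lambda>(c, e). (c, g ` e)) ` edges H"
    using assms(2) unfolding isomorphic_def by blast
  show ?thesis unfolding isomorphic_def
    by (rule exI[of _ "g \<circ> f"])
      (use bij_betw_trans[OF f(1) g(1)] in
        \<open>simp add: f(2) g(2) image_image case_prod_unfold o_def\<close>)
qed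

lemma regular_subset:
  "regular_coloured C G \<Longrightarrow> \<forall>(c, e) \<in> edges G. e \<subseteq> verts G"
  unfolding regular_coloured_def by blast

abbreviation iso_rel :: "nat \<Rightarrow> 'v cgraph \<Rightarrow> (nat cgraph \<times> nat cgraph) set" where
  "iso_rel D B \<equiv>
     {(G, H). G \<in> labelled_graphs D B \<and> H \<in> labelled_graphs D B \<and> isomorphic G H}"

lemma equiv_iso_rel: "equiv (labelled_graphs D B) (iso_rel D B)"
proof (rule equivI)
  show "refl_on (labelled_graphs D B) (iso_rel D B)"
    by (auto simp: refl_on_def isomorphic_refl)
  show "sym (iso_rel D B)"
    by (rule symI)
      (auto simp: labelled_graphs_def intro: isomorphic_sym dest: regular_subset)
  show "trans (iso_rel D B)"
    by (rule transI) (auto intro: isomorphic_trans)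
qed auto

lemma class_some:
  assumes "X \<in> labelled_graphs D B // iso_rel D B"
  shows "(SOME G. G \<in> X) \<in> X"
  using in_quotient_imp_non_empty[OF equiv_iso_rel assms] by (simp add: some_in_eq)

lemma tildeG_subset: "tildeG D B \<subseteq> labelled_graphs D B"
  unfolding tildeG_def
  using class_some in_quotient_imp_subset[OF equiv_iso_rel] by blast

lemma tildeG_representative:
  assumes "G \<in> labelled_graphs D B"
  shows "\<exists>!H. H \<in> tildeG D B \<and> isomorphic G H"
proof (rule ex1I)
  let ?X = "iso_rel D B `` {G}"
  have X: "?X \<in> labelled_graphs D B // iso_rel D B" using assms by (rule quotientI)
  show "(SOME H. H \<in> ?X) \<in> tildeG D B \<and> isomorphic G (SOME H. H \<in> ?X)"
  proof
    show "(SOME H. H \<in> ?X) \<in> tildeG D B" unfolding tildeG_def using X by (rule imageI)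
    show "isomorphic G (SOME H. H \<in> ?X)" using class_some[OF X] by blast
  qed
  fix H assume H: "H \<in> tildeG D B \<and> isomorphic G H"
  then obtain Y where Y: "Y \<in> labelled_graphs D B // iso_rel D B" "H = (SOME H. H \<in> Y)"
    unfolding tildeG_def by blast
  have "H \<in> Y" using class_some[OF Y(1)] Y(2) by simp
  moreover have "H \<in> ?X" using H assms tildeG_subset by auto
  moreover have "G \<in> ?X" using assms by (simp add: isomorphic_refl)
  moreover have "(H, H) \<in> iso_rel D B"
    using H tildeG_subset isomorphic_refl by blast
  ultimately have "Y = ?X"
    using quotient_eq_iff[OF equiv_iso_rel Y(1) X] by blast
  then show "H = (SOME H. H \<in> ?X)" using Y(2) by simp
qed

lemma adj_sym: "adj G u v \<Longrightarrow> adj G v u"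
  by (simp add: adj_def insert_commute)

lemma reach_sym: "(adj G)\<^sup>*\<^sup>* u v \<Longrightarrow> (adj G)\<^sup>*\<^sup>* v u"
  by (induction rule: rtranclp_induct)
    (auto intro: converse_rtranclp_into_rtranclp adj_sym)

lemma reach_verts:
  assumes "\<forall>(c, e) \<in> edges G. e \<subseteq> verts G" "(adj G)\<^sup>*\<^sup>* u v" "u \<in> verts G"
  shows "v \<in> verts G"
  using assms(2,3)
  by (induction rule: rtranclp_induct) (use assms(1) in \<open>auto simp: adj_def\<close>)

lemma isomorphic_card: "isomorphic G H \<Longrightarrow> card (verts G) = card (verts H)"
  unfolding isomorphic_def by (blast intro: bij_betw_same_card)

lemma components_verts:
  assumes "\<forall>(c, e) \<in> edges G. e \<subseteq> verts G"
  shows "(\<Union>H \<in> components G. verts H) = verts G"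
  using reach_verts[OF assms] unfolding components_def component_of_def by auto

lemma components_disjoint:
  assumes "H \<in> components G" "K \<in> components G" "v \<in> verts H" "v \<in> verts K"
  shows "H = K"
proof -
  obtain a b where ab: "H = component_of G a" "K = component_of G b"
    using assms unfolding components_def by blast
  have "(adj G)\<^sup>*\<^sup>* a v" "(adj G)\<^sup>*\<^sup>* b v"
    using assms(3,4) ab unfolding component_of_def by auto
  then have "(adj G)\<^sup>*\<^sup>* a b" "(adj G)\<^sup>*\<^sup>* b a"
    using reach_sym rtranclp_trans by metis+
  then have "{w. (adj G)\<^sup>*\<^sup>* a w} = {w. (adj G)\<^sup>*\<^sup>* b w}"
    using rtranclp_trans[of "adj G"] by blast
  then show ?thesis using ab unfolding component_of_def by simp
qed

lemma card_verts_labelled: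
  assumes "G \<in> labelled_graphs D B"
  shows "card (verts G) = num_bubbles G * card (verts B)"
proof -
  let ?G = "delete_colour 0 G"
  have G: "regular_coloured {0..D} G"
    and iso: "\<And>H. H \<in> components ?G \<Longrightarrow> isomorphic H B"
    using assms unfolding labelled_graphs_def by auto
  have sub: "\<forall>(c, e) \<in> edges ?G. e \<subseteq> verts ?G"
    using regular_subset[OF G] by (auto simp: delete_colour_def)
  have fin: "finite (verts G)" using G unfolding regular_coloured_def by blast
  have finc: "finite (components ?G)"
    using fin by (simp add: components_def delete_colour_def)
  have V: "(\<Union>H \<in> components ?G. verts H) = verts G"
    using components_verts[OF sub] by (simp add: delete_colour_def)
  have "card (verts G) = (\<Sum>H \<in> components ?G. card (verts H))"
    unfolding V[symmetric]
  proof (rule card_UN_disjoint[OF finc])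
    show "\<forall>H \<in> components ?G. finite (verts H)"
      using fin V by (metis UN_upper finite_subset)
    show "\<forall>H \<in> components ?G. \<forall>K \<in> components ?G. H \<noteq> K \<longrightarrow> verts H \<inter> verts K = {}"
      using components_disjoint by (metis disjoint_iff)
  qed
  also have "\<dots> = (\<Sum>H \<in> components ?G. card (verts B))"
    by (rule sum.cong) (auto intro: isomorphic_card iso)
  finally show ?thesis by (simp add: num_bubbles_def)
qed

lemma finite_num_bubbles:
  "finite {G \<in> tildeG D B. num_bubbles G = n}"
proof -
  let ?m = "n * card (verts B)"
  let ?S = "(\<lambda>(V, E). \<lparr>verts = V, edges = E\<rparr>) `
              ({{..<?m}} \<times> Pow ({0..D} \<times> Pow {..<?m})) :: nat cgraph set"
  let ?r = "\<lambda>H. THE G. G \<in> tildeG D B \<and> isomorphic G H"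
  have "G \<in> ?r ` ?S" if "G \<in> tildeG D B" "num_bubbles G = n" for G
  proof -
    have L: "G \<in> labelled_graphs D B" using that tildeG_subset by blast
    then have R: "regular_coloured {0..D} G" unfolding labelled_graphs_def by blast
    have "card (verts G) = ?m" using card_verts_labelled[OF L] that(2) by simp
    moreover have "finite (verts G)" using R unfolding regular_coloured_def by blast
    ultimately obtain f where f: "bij_betw f (verts G) {..<?m}"
      using bij_betw_iff_card[of "verts G" "{..<?m}"] by auto
    define H where "H = \<lparr>verts = {..<?m}, edges = (\<lambda>(c, e). (c, f ` e)) ` edges G\<rparr>"
    have iso: "isomorphic G H" unfolding isomorphic_def H_def using f by auto
    have "edges H \<subseteq> {0..D} \<times> Pow {..<?m}"
      using R f unfolding regular_coloured_def H_def bij_betw_def by fastforce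
    then have "H \<in> ?S" unfolding H_def by (intro image_eqI[of _ _ "({..<?m}, edges H)"])
        (auto simp: H_def)
    moreover have "?r H = G"
    proof (rule the_equality)
      fix K assume K: "K \<in> tildeG D B \<and> isomorphic K H"
      have "isomorphic H G" using iso regular_subset[OF R] by (rule isomorphic_sym)
      then have "isomorphic K G" using K isomorphic_trans by blast
      moreover have "K \<in> labelled_graphs D B" using K tildeG_subset by blast
      ultimately show "K = G"
        using tildeG_representative[of K] that K isomorphic_refl by blast
    qed (use that iso in simp)
    ultimately show ?thesis by blast
  qed
  then have "{G \<in> tildeG D B. num_bubbles G = n} \<subseteq> ?r ` ?S" by blast
  then show ?thesis by (rule finite_subset) (intro finite_imageI, simp)
qed

lemma alternating_cycle_closed_walk:
  assumes "alternating_cycle i j G C"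
  obtains n x where "0 < n" "even n" "inj_on x {..<n}"
    "C = (\<lambda>t. (if even t then i else j, {x t, x (Suc t mod n)})) ` {..<n}"
proof -
  obtain k :: nat and x where k: "0 < k" "inj_on x {..<2 * k}" and
    C: "C = (\<Union>m<k. {(i, {x (2 * m), x (2 * m + 1)}),
                     (j, {x (2 * m + 1), x ((2 * m + 2) mod (2 * k))})})"
    using assms unfolding alternating_cycle_def by (elim conjE exE) (rule that)
  let ?g = "\<lambda>t. (if even t then i else j, {x t, x (Suc t mod (2 * k))})"
  have e: "?g (2 * m) = (i, {x (2 * m), x (2 * m + 1)})"
    "?g (2 * m + 1) = (j, {x (2 * m + 1), x ((2 * m + 2) mod (2 * k))})" if "m < k" for m
    using that by simp_all
  have "{..<2 * k} = (\<Union>m<k. {2 * m, 2 * m + 1})"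
  proof (rule set_eqI)
    fix t
    show "t \<in> {..<2 * k} \<longleftrightarrow> t \<in> (\<Union>m<k. {2 * m, 2 * m + 1})"
      by (auto intro!: bexI[of _ "t div 2"])
  qed
  then have "?g ` {..<2 * k} = (\<Union>m<k. {?g (2 * m), ?g (2 * m + 1)})"
    by (simp add: image_UN del: e)
  also have "\<dots> = C" unfolding C using e by (intro SUP_cong) auto
  finally show ?thesis using that[of "2 * k" x] k by auto
qed

lemma alternating_cycle_closed:
  assumes G: "regular_coloured K G" and ij: "i \<in> K" "j \<in> K" and C: "alternating_cycle i j G C"
    and v: "v \<in> \<Union> (snd ` C)" and e: "(c, e) \<in> edges G" "v \<in> e" "c \<in> {i, j}"
  shows "(c, e) \<in> C"
proof -
  obtain n x where n: "0 < n" "even n" "inj_on x {..<n}" and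
    Ceq: "C = (\<lambda>t. (if even t then i else j, {x t, x (Suc t mod n)})) ` {..<n}"
    using alternating_cycle_closed_walk[OF C] .
  obtain t where t: "t < n" "v = x t"
  proof -
    obtain s where s: "s < n" "v = x s \<or> v = x (Suc s mod n)"
      using v unfolding Ceq by auto
    then show ?thesis using that[of s] that[of "Suc s mod n"] n(1) by auto
  qed
  define s where "s = (if t = 0 then n - 1 else t - 1)"
  have s: "s < n" "Suc s mod n = t" "even s \<longleftrightarrow> odd t"
    using t n by (auto simp: s_def)
  have "(if even t then i else j, {x t, x (Suc t mod n)}) \<in> C"
    "(if even s then i else j, {x s, x (Suc s mod n)}) \<in> C"
    using t s unfolding Ceq by auto
  then obtain e1 e2 where 1: "(i, e1) \<in> C" "v \<in> e1" and 2: "(j, e2) \<in> C" "v \<in> e2"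
    using t(2) s(2,3) by (cases "even t") auto
  have sub: "C \<subseteq> edges G" using C unfolding alternating_cycle_def by blast
  have "v \<in> verts G" using regular_subset[OF G] e by blast
  then have "\<And>c e e'. c \<in> K \<Longrightarrow> (c, e) \<in> edges G \<Longrightarrow> v \<in> e \<Longrightarrow> (c, e') \<in> edges G \<Longrightarrow> v \<in> e' \<Longrightarrow> e = e'"
    using G unfolding regular_coloured_def by metis
  then show ?thesis using 1 2 sub e ij by blast
qed

lemma alternating_cycle_eq:
  assumes G: "regular_coloured K G" and ij: "i \<in> K" "j \<in> K"
    and C: "alternating_cycle i j G C" and C': "alternating_cycle i j G C'"
    and v: "v \<in> \<Union> (snd ` C)" "v \<in> \<Union> (snd ` C')"
  shows "C \<subseteq> C'"
proof -
  obtain n x where n: "0 < n" "even n" "inj_on x {..<n}" and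
    Ceq: "C = (\<lambda>t. (if even t then i else j, {x t, x (Suc t mod n)})) ` {..<n}"
    using alternating_cycle_closed_walk[OF C] .
  have sub: "C \<subseteq> edges G" using C unfolding alternating_cycle_def by blast
  have edge: "(if even t then i else j, {x t, x (Suc t mod n)}) \<in> C'"
    if "x t \<in> \<Union> (snd ` C')" "t < n" for t
    by (rule alternating_cycle_closed[OF G ij C' that(1)])
      (use that(2) sub in \<open>auto simp: Ceq\<close>)
  obtain a where a: "a < n" "v = x a"
  proof -
    obtain s where s: "s < n" "v = x s \<or> v = x (Suc s mod n)"
      using v unfolding Ceq by auto
    then show ?thesis using that[of s] that[of "Suc s mod n"] n(1) by auto
  qed
  have walk: "x ((a + s) mod n) \<in> \<Union> (snd ` C')" for s
  proof (induction s)
    case 0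
    then show ?case using a v(2) by simp
  next
    case (Suc s)
    then show ?case using edge[OF Suc] n(1) by (force simp: mod_Suc_eq)
  qed
  have "x t \<in> \<Union> (snd ` C')" if "t < n" for t
    using walk[of "n + t - a"] a that by simp
  then show ?thesis unfolding Ceq using edge by blast
qed

lemma Phi0i_le:
  assumes G: "regular_coloured {0..D} G" and i: "i \<in> {1..D}"
  shows "Phi0i i G \<le> card (verts G)"
  unfolding Phi0i_def
proof (rule card_inj_on_le)
  let ?p = "\<lambda>C. SOME v. v \<in> \<Union> (snd ` C)"
  have p: "?p C \<in> \<Union> (snd ` C)" if C: "alternating_cycle 0 i G C" for C
  proof -
    obtain n x where n: "0 < n"
      "C = (\<lambda>t. (if even t then 0 else i, {x t, x (Suc t mod n)})) ` {..<n}"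
      using alternating_cycle_closed_walk[OF C] by blast
    have "x 0 \<in> \<Union> (snd ` C)" using n(1) unfolding n(2) by force
    then show ?thesis by (rule someI)
  qed
  show "inj_on ?p {C. alternating_cycle 0 i G C}"
  proof (rule inj_onI)
    fix C C' assume "C \<in> {C. alternating_cycle 0 i G C}" "C' \<in> {C. alternating_cycle 0 i G C}"
      "?p C = ?p C'"
    then have C: "alternating_cycle 0 i G C" "alternating_cycle 0 i G C'"
      "?p C \<in> \<Union> (snd ` C)" "?p C \<in> \<Union> (snd ` C')" using p by fastforce+
    have 0: "0 \<in> {0..D}" "i \<in> {0..D}" using i by auto
    show "C = C'"
      using alternating_cycle_eq[OF G 0 C(1,2,3,4)] alternating_cycle_eq[OF G 0 C(2,1,4,3)]
      by blast
  qed
  show "?p ` {C. alternating_cycle 0 i G C} \<subseteq> verts G"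
  proof (rule image_subsetI)
    fix C assume "C \<in> {C. alternating_cycle 0 i G C}"
    then have "?p C \<in> \<Union> (snd ` C)" "C \<subseteq> edges G"
      using p unfolding alternating_cycle_def by simp_all
    then show "?p C \<in> verts G" using regular_subset[OF G] by fastforce
  qed
  show "finite (verts G)" using G unfolding regular_coloured_def by blast
qed

lemma bdd_above_alphaM:
  "bdd_above ((\<lambda>G. (real (Phi0 D G) - real D) / real (num_bubbles G)) ` tildeG D B)"
proof (rule bdd_aboveI2)
  fix G assume "G \<in> tildeG D B"
  then have L: "G \<in> labelled_graphs D B" using tildeG_subset by blast
  then have G: "regular_coloured {0..D} G" unfolding labelled_graphs_def by blast
  have "Phi0 D G \<le> (\<Sum>i=1..D. num_bubbles G * card (verts B))"
    unfolding Phi0_def card_verts_labelled[OF L, symmetric]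
    using Phi0i_le[OF G] by (rule sum_mono)
  then have "real (Phi0 D G) \<le> real (D * (num_bubbles G * card (verts B)))"
    by (simp only: of_nat_le_iff) simp
  then have "real (Phi0 D G) - real D \<le> real (D * card (verts B)) * real (num_bubbles G)"
    by (simp add: mult.commute mult.left_commute)
  then show "(real (Phi0 D G) - real D) / real (num_bubbles G) \<le> real (D * card (verts B))"
    by (cases "num_bubbles G = 0") (auto simp: divide_le_eq)
qed

lemma isomorphic_regular:
  assumes "isomorphic G H" "regular_coloured C G"
  shows "regular_coloured C H"
proof -
  obtain f where f: "bij_betw f (verts G) (verts H)"
    and E: "edges H = (\<lambda>(c, e). (c, f ` e)) ` edges G"
    using assms(1) unfolding isomorphic_def by blast
  have inj: "inj_on f (verts G)" and V: "verts H = f ` verts G"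
    using f unfolding bij_betw_def by auto
  have e: "c \<in> C \<and> e \<subseteq> verts G \<and> card e = 2" if "(c, e) \<in> edges G" for c e
    using assms(2) that unfolding regular_coloured_def by blast
  have "\<exists>!e. (c, e) \<in> edges H \<and> w \<in> e" if w: "w \<in> verts H" and c: "c \<in> C" for w c
  proof -
    obtain v where v: "v \<in> verts G" "w = f v" using w V by blast
    have "\<forall>v \<in> verts G. \<forall>c \<in> C. \<exists>!e. (c, e) \<in> edges G \<and> v \<in> e"
      using assms(2) unfolding regular_coloured_def by (elim conjE)
    then have "\<exists>!e. (c, e) \<in> edges G \<and> v \<in> e" using v(1) c by simp
    then obtain e0 where e0: "(c, e0) \<in> edges G" "v \<in> e0"
      and u: "\<And>e. (c, e) \<in> edges G \<Longrightarrow> v \<in> e \<Longrightarrow> e = e0"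
      by auto
    show ?thesis
    proof (rule ex1I)
      show "(c, f ` e0) \<in> edges H \<and> w \<in> f ` e0" using e0 v unfolding E by force
      fix e' assume "(c, e') \<in> edges H \<and> w \<in> e'"
      then obtain e1 where e1: "(c, e1) \<in> edges G" "e' = f ` e1" "f v \<in> f ` e1"
        using v unfolding E by auto
      then have "v \<in> e1" using e[OF e1(1)] v(1) inj by (meson inj_on_image_mem_iff)
      then show "e' = f ` e0" using u e1 by blast
    qed
  qed
  moreover have "c \<in> C \<and> e' \<subseteq> verts H \<and> card e' = 2" if e': "(c, e') \<in> edges H" for c e'
  proof -
    obtain e1 where "(c, e1) \<in> edges G" "e' = f ` e1" using e' unfolding E by auto
    then show ?thesis using e[of c e1] V inj
      by (auto simp: card_image inj_on_subset)
  qed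
  moreover have "finite (verts H)" using assms(2) V unfolding regular_coloured_def by simp
  ultimately show ?thesis unfolding regular_coloured_def by blast
qed

lemma isomorphic_connected:
  assumes "isomorphic G H" "connected_graph G"
  shows "connected_graph H"
proof -
  obtain f where f: "bij_betw f (verts G) (verts H)"
    and E: "edges H = (\<lambda>(c, e). (c, f ` e)) ` edges G"
    using assms(1) unfolding isomorphic_def by blast
  have V: "verts H = f ` verts G" using f unfolding bij_betw_def by auto
  have "(adj H)\<^sup>*\<^sup>* (f u) (f v)" if "(adj G)\<^sup>*\<^sup>* u v" for u v
    using that
  proof (induction rule: rtranclp_induct)
    case (step y z)
    have "adj H (f y) (f z)" using step(2) unfolding adj_def E by force
    then show ?case using step(3) by simp
  qed simp
  then show ?thesis using assms(2) unfolding connected_graph_def V by blast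
qed

lemma component_of_connected:
  assumes "\<forall>(c, e) \<in> edges G. e \<subseteq> verts G" "connected_graph G" "v \<in> verts G"
  shows "component_of G v = G"
proof -
  have "{w. (adj G)\<^sup>*\<^sup>* v w} = verts G"
    using reach_verts[OF assms(1)] assms(2,3) unfolding connected_graph_def by blast
  moreover have "{(c, e) \<in> edges G. e \<subseteq> verts G} = edges G" using assms(1) by blast
  ultimately show ?thesis by (simp add: component_of_def)
qed

lemma tildeG_nonempty:
  assumes "1 \<le> D" "bubble D B"
  shows "tildeG D B \<noteq> {}"
proof -
  have B: "regular_coloured {1..D} B" "connected_graph B"
    using assms(2) unfolding bubble_def by auto
  have "finite (verts B)" using B unfolding regular_coloured_def by blast
  then obtain f :: "'a \<Rightarrow> nat" where f: "inj_on f (verts B)"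
    using finite_imp_inj_to_nat_seg by blast
  define K where "K = \<lparr>verts = f ` verts B, edges = (\<lambda>(c, e). (c, f ` e)) ` edges B\<rparr>"
  have iso: "isomorphic B K"
    unfolding isomorphic_def K_def using f by (auto simp: bij_betw_def)
  have K: "regular_coloured {1..D} K" "connected_graph K"
    using isomorphic_regular[OF iso B(1)] isomorphic_connected[OF iso B(2)] .
  have iso': "isomorphic K B" using iso regular_subset[OF B(1)] by (rule isomorphic_sym)
  define G where "G = \<lparr>verts = verts K, edges = edges K \<union> {(0, e) | e. (1, e) \<in> edges K}\<rparr>"
  have c: "c \<in> {1..D}" if "(c, e) \<in> edges K" for c e
    using K(1) that unfolding regular_coloured_def by blast
  then have no0: "(0, e) \<notin> edges K" for e by fastforce
  have "edges (delete_colour 0 G) = edges K"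
    using no0 by (auto simp: delete_colour_def G_def intro: gr0I)
  then have del: "delete_colour 0 G = K"
    by (simp add: delete_colour_def G_def)
  have "components K = {K}"
    using component_of_connected[OF regular_subset[OF K(1)] K(2)] K(2)
    unfolding components_def connected_graph_def by auto
  moreover have "connected_graph G"
  proof -
    have "adj K \<le> adj G" by (auto simp: adj_def G_def)
    then have "(adj K)\<^sup>*\<^sup>* \<le> (adj G)\<^sup>*\<^sup>*" by (rule rtranclp_mono)
    then show ?thesis using K(2) unfolding connected_graph_def by (auto simp: G_def)
  qed
  moreover have "regular_coloured {0..D} G"
  proof -
    have one: "\<forall>v \<in> verts K. \<forall>c \<in> {1..D}. \<exists>!e. (c, e) \<in> edges K \<and> v \<in> e"
      using K(1) unfolding regular_coloured_def by (elim conjE)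
    have "\<exists>!e. (c, e) \<in> edges G \<and> v \<in> e" if v: "v \<in> verts G" and c: "c \<in> {0..D}" for v c
    proof (cases "c = 0")
      case True
      have "\<exists>!e. (1, e) \<in> edges K \<and> v \<in> e"
        using one v assms(1) by (simp add: G_def)
      then show ?thesis using True no0 by (simp add: G_def)
    next
      case False
      then have "\<exists>!e. (c, e) \<in> edges K \<and> v \<in> e"
        using one v c by (simp add: G_def)
      then show ?thesis using False by (simp add: G_def)
    qed
    moreover have "c \<in> {0..D} \<and> e \<subseteq> verts G \<and> card e = 2" if "(c, e) \<in> edges G" for c e
      using that K(1) unfolding regular_coloured_def by (fastforce simp: G_def)
    moreover have "finite (verts G)"
      using K(1) unfolding regular_coloured_def by (simp add: G_def)
    ultimately show ?thesis unfolding regular_coloured_def by blast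
  qed
  ultimately have "G \<in> labelled_graphs D B"
    using iso' del unfolding labelled_graphs_def by simp
  then show ?thesis using tildeG_representative by blast
qed

end

theory Submission
  imports Defs
begin

text \<open>If the parameter exceeds the supremum, the degree grows at least linearly with the number of
  bubbles, so every order is finite; if it is smaller, some degree is negative. When the supremum is
  attained, it is rational and the maximizer has degree 0. Cutting an edge of colour 0 in each of
  two graphs and reconnecting the ends crosswise yields a connected graph: bubbles add up, and for
  each colour i the two cycles of colours 0 and i through the cut edges merge into one. So the
  degree is additive under this operation, and repeated sums of the maximizer with itself give
  infinitely many graphs of degree 0.\<close>

section \<open>Edges of a regular coloured graph and its alternating cycles\<close>

lemma regular_colouredD:
  assumes "regular_coloured K G"
  shows "finite (verts G)"
    and "(c, e) \<in> edges G \<Longrightarrow> c \<in> K" "(c, e) \<in> edges G \<Longrightarrow> e \<subseteq> verts G"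
    and "(c, e) \<in> edges G \<Longrightarrow> card e = 2"
    and "v \<in> verts G \<Longrightarrow> c \<in> K \<Longrightarrow> \<exists>!e. (c, e) \<in> edges G \<and> v \<in> e"
proof -
  show "finite (verts G)"
    using assms unfolding regular_coloured_def by (elim conjE)
  have E: "\<forall>(c, e) \<in> edges G. c \<in> K \<and> e \<subseteq> verts G \<and> card e = 2"
    using assms unfolding regular_coloured_def by (elim conjE)
  have V: "\<forall>v \<in> verts G. \<forall>c \<in> K. \<exists>!e. (c, e) \<in> edges G \<and> v \<in> e"
    using assms unfolding regular_coloured_def by (elim conjE)
  show "(c, e) \<in> edges G \<Longrightarrow> c \<in> K" "(c, e) \<in> edges G \<Longrightarrow> e \<subseteq> verts G"
    "(c, e) \<in> edges G \<Longrightarrow> card e = 2"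
    using E by auto
  show "v \<in> verts G \<Longrightarrow> c \<in> K \<Longrightarrow> \<exists>!e. (c, e) \<in> edges G \<and> v \<in> e"
    using V by simp
qed

lemma regular_coloured_edge_unique:
  assumes G: "regular_coloured K G"
    and "(c, e) \<in> edges G" "(c, e') \<in> edges G" "v \<in> e" "v \<in> e'"
  shows "e = e'"
proof -
  have "v \<in> verts G" "c \<in> K" using regular_colouredD[OF G] assms by blast+
  then show ?thesis using regular_colouredD(5)[OF G] assms by metis
qed

lemma regular_coloured_neighbour:
  assumes G: "regular_coloured K G" and v: "v \<in> verts G" "c \<in> K"
  obtains w where "w \<in> verts G" "w \<noteq> v" "(c, {v, w}) \<in> edges G"
proof -
  obtain e where e: "(c, e) \<in> edges G" "v \<in> e"
    using regular_colouredD(5)[OF G v] by blast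
  obtain w where "e = {v, w}" "w \<noteq> v"
    using regular_colouredD(4)[OF G e(1)] e(2) by (auto simp: card_2_iff)
  then show thesis using that e(1) regular_colouredD(3)[OF G e(1)] by blast
qed

lemma finite_edges:
  assumes "regular_coloured K G" "finite K"
  shows "finite (edges G)"
proof (rule finite_subset)
  show "edges G \<subseteq> K \<times> Pow (verts G)"
    using regular_colouredD(2,3)[OF assms(1)] by fast
  show "finite (K \<times> Pow (verts G))"
    using regular_colouredD(1)[OF assms(1)] assms(2) by simp
qed

text \<open>Follow the edges of colours i, j, i, j, ... from v. As every colour occurs exactly once at
  every vertex, the first vertex visited twice is v itself, and it is reached through colour j.\<close>

lemma alternating_walk_exists:
  assumes G: "regular_coloured K G" and ij: "i \<in> K" "j \<in> K" and v: "v \<in> verts G"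
  obtains n x where "0 < n" "even n" "inj_on x {..<n}" "x 0 = v"
    "\<And>t. t < n \<Longrightarrow> (if even t then i else j, {x t, x (Suc t mod n)}) \<in> edges G"
proof -
  define col where "col t = (if even t then i else j)" for t :: nat
  define s where "s c u = (SOME w. w \<in> verts G \<and> w \<noteq> u \<and> (c, {u, w}) \<in> edges G)" for c u
  have s: "s c u \<in> verts G \<and> s c u \<noteq> u \<and> (c, {u, s c u}) \<in> edges G"
    if "u \<in> verts G" "c \<in> K" for c u
    unfolding s_def by (rule someI_ex) (use regular_coloured_neighbour[OF G that] in blast)
  define x where "x = rec_nat v (\<lambda>t u. s (col t) u)"
  have x0: "x 0 = v" and xS: "x (Suc t) = s (col t) (x t)" for t
    by (simp_all add: x_def)
  have col: "col t \<in> K" for t using ij by (simp add: col_def)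
  have xV: "x t \<in> verts G" for t
    by (induction t) (use v s col in \<open>auto simp: x0 xS\<close>)
  have edge: "(col t, {x t, x (Suc t)}) \<in> edges G" and ne: "x (Suc t) \<noteq> x t" for t
    using s[OF xV col] by (auto simp: xS)
  have same: "p = q" if "(c, {u, p}) \<in> edges G" "(c, {u, q}) \<in> edges G" for c u p q
    using regular_coloured_edge_unique[OF G that, of u] by (auto simp: doubleton_eq_iff)
  have "\<not> inj x"
  proof
    assume "inj x"
    moreover have "finite (range x)"
      using xV by (intro finite_subset[OF _ regular_colouredD(1)[OF G]]) blast
    ultimately show False using finite_imageD by blast
  qed
  then obtain p q where "p < q" "x p = x q"
    unfolding inj_on_def by (metis linorder_neqE_nat)
  then have ex: "\<exists>n. \<exists>m<n. x m = x n" by metis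
  \<comment> \<open>First time at which the walk meets a vertex already visited; the vertices before
    that time are pairwise distinct.\<close>
  define n where "n = (LEAST n. \<exists>m<n. x m = x n)"
  obtain m where m: "m < n" "x m = x n"
    using LeastI_ex[OF ex] unfolding n_def by blast
  have new: "p = q" if "p < n" "q < n" "x p = x q" for p q
    using that not_less_Least[of p "\<lambda>n. \<exists>m<n. x m = x n"]
      not_less_Least[of q "\<lambda>n. \<exists>m<n. x m = x n"]
    unfolding n_def by (metis linorder_neqE_nat)
  obtain l where l: "n = Suc l" using m(1) by (cases n) auto
  have el: "(col l, {x m, x l}) \<in> edges G"
    using edge[of l] m(2) l by (simp add: insert_commute)
  \<comment> \<open>With equal parities the closing edge would have the colour of the edge leaving
    \<open>x m\<close>, hence \<open>x l = x (Suc m)\<close> and \<open>l = Suc m\<close>, whose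
    parity differs from that of \<open>m\<close>.\<close>
  have parity: "odd l \<longleftrightarrow> even m"
  proof (rule ccontr)
    assume "\<not> (odd l \<longleftrightarrow> even m)"
    then have par: "even l \<longleftrightarrow> even m" by blast
    then have "x l = x (Suc m)"
      using el edge[of m] same by (metis col_def)
    moreover have "m \<noteq> l" using m(2) ne[of l] l by auto
    ultimately have "l = Suc m" using new[of l "Suc m"] m(1) l by auto
    then show False using par by simp
  qed
  \<comment> \<open>Otherwise the edge entering \<open>x m\<close> from \<open>x m'\<close> would
    have the colour of the closing edge, and \<open>x l = x m'\<close> would be a repetition before
    time \<open>n\<close>.\<close>
  have "m = 0"
  proof (rule ccontr)
    assume "m \<noteq> 0"
    then obtain m' where m': "m = Suc m'" by (cases m) auto
    have "col m' = col l" using parity m' by (auto simp: col_def)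
    then have "(col l, {x m, x m'}) \<in> edges G"
      using edge[of m'] m' by (simp add: insert_commute)
    then have "x l = x m'" by (rule same[OF el])
    then show False using new[of l m'] m(1) m' l by auto
  qed
  show thesis
  proof (rule that[of n x])
    show "inj_on x {..<n}" using new by (auto intro: inj_onI)
    show "(if even t then i else j, {x t, x (Suc t mod n)}) \<in> edges G" if "t < n" for t
    proof (cases "Suc t = n")
      case True
      then show ?thesis using edge[of t] m(2) \<open>m = 0\<close> by (simp add: col_def)
    next
      case False
      then show ?thesis using edge[of t] that by (simp add: col_def)
    qed
  qed (use m \<open>m = 0\<close> parity l x0 in auto)
qed

text \<open>The \<open>2 * k\<close> steps of the closed walk are grouped in pairs: step
  \<open>2 * m\<close> has colour \<open>i\<close> and step \<open>2 * m + 1\<close> has colour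
  \<open>j\<close>.\<close>

lemma alternating_cycle_exists:
  assumes G: "regular_coloured K G" and ij: "i \<in> K" "j \<in> K" and v: "v \<in> verts G"
  obtains C where "alternating_cycle i j G C" "v \<in> \<Union> (snd ` C)"
proof -
  obtain n x where n: "0 < n" "even n" "inj_on x {..<n}" "x 0 = v"
    and e: "\<And>t. t < n \<Longrightarrow> (if even t then i else j, {x t, x (Suc t mod n)}) \<in> edges G"
    using alternating_walk_exists[OF assms] by metis
  obtain k where k: "n = 2 * k" using n(2) by blast
  define C where "C = (\<Union>m<k. {(i, {x (2 * m), x (2 * m + 1)}),
                     (j, {x (2 * m + 1), x ((2 * m + 2) mod (2 * k))})})"
  have "C \<subseteq> edges G"
    using e[of "2 * m" for m] e[of "2 * m + 1" for m] by (auto simp: C_def k)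
  then have "alternating_cycle i j G C"
    unfolding alternating_cycle_def using n k by (auto intro!: exI[of _ k] exI[of _ x] simp: C_def)
  moreover have "(i, {x 0, x 1}) \<in> C"
    using n(1) by (auto simp: C_def k intro!: bexI[of _ 0])
  then have "v \<in> \<Union> (snd ` C)" using n(4) by force
  ultimately show thesis by (rule that)
qed

section \<open>Invariance under isomorphism\<close>

lemma isomorphic_alternating_cycle:
  assumes "edges H = (\<lambda>(c, e). (c, f ` e)) ` edges G" "inj_on f (verts G)"
    and "\<forall>(c, e) \<in> edges G. e \<subseteq> verts G" "alternating_cycle i j G C"
  shows "alternating_cycle i j H ((\<lambda>(c, e). (c, f ` e)) ` C)"
proof -
  obtain k :: nat and x where k: "0 < k" "inj_on x {..<2 * k}" and
    C: "C = (\<Union>m<k. {(i, {x (2 * m), x (2 * m + 1)}),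
                     (j, {x (2 * m + 1), x ((2 * m + 2) mod (2 * k))})})"
    and sub: "C \<subseteq> edges G"
    using assms(4) unfolding alternating_cycle_def by (elim conjE exE) (rule that)
  \<comment> \<open>The vertex \<open>x t\<close> lies on the edge of colour \<open>i\<close>
    numbered \<open>t div 2\<close>, so it belongs to \<open>verts G\<close>, where \<open>f\<close>
    is injective; hence the image walk has distinct vertices too.\<close>
  have "x t \<in> verts G" if "t < 2 * k" for t
  proof -
    have "t div 2 < k" using that by auto
    then have "(i, {x (2 * (t div 2)), x (2 * (t div 2) + 1)}) \<in> edges G"
      using sub unfolding C by blast
    then have "{x (2 * (t div 2)), x (2 * (t div 2) + 1)} \<subseteq> verts G"
      using assms(3) by blast
    then show ?thesis by (cases "even t") (auto elim!: oddE)
  qed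
  then have "inj_on (f \<circ> x) {..<2 * k}"
    using k(2) assms(2) by (intro comp_inj_on inj_on_subset[OF assms(2)]) auto
  moreover have "(\<lambda>(c, e). (c, f ` e)) ` C =
    (\<Union>m<k. {(i, {(f \<circ> x) (2 * m), (f \<circ> x) (2 * m + 1)}),
             (j, {(f \<circ> x) (2 * m + 1), (f \<circ> x) ((2 * m + 2) mod (2 * k))})})"
    unfolding C by (simp add: image_UN)
  moreover have "(\<lambda>(c, e). (c, f ` e)) ` C \<subseteq> edges H"
    using sub assms(1) by blast
  ultimately show ?thesis unfolding alternating_cycle_def using k(1) by blast
qed

lemma finite_alternating_cycles:
  assumes "regular_coloured {0..D} G"
  shows "finite {C. alternating_cycle i j G C}"
proof (rule finite_subset)
  show "{C. alternating_cycle i j G C} \<subseteq> Pow (edges G)"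
    unfolding alternating_cycle_def by blast
  show "finite (Pow (edges G))" using finite_edges[OF assms] by simp
qed

text \<open>Distinct cycles have distinct images. One inequality is enough later on: the degree of a
  representative only has to be bounded above, its lower bound being
  \<open>delta_alphaM_nonneg\<close>.\<close>

lemma isomorphic_Phi0_le:
  assumes "isomorphic G H" and G: "regular_coloured {0..D} G"
  shows "Phi0 D G \<le> Phi0 D H"
proof -
  obtain f where f: "bij_betw f (verts G) (verts H)"
    and E: "edges H = (\<lambda>(c, e). (c, f ` e)) ` edges G"
    using assms(1) unfolding isomorphic_def by blast
  let ?F = "\<lambda>(c, e). (c, f ` e)"
  have inj: "inj_on f (verts G)" using f by (simp add: bij_betw_def)
  have injE: "inj_on ?F (edges G)"
  proof (rule inj_onI)
    fix p q assume pq: "p \<in> edges G" "q \<in> edges G" "?F p = ?F q"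
    obtain c e c' e' where [simp]: "p = (c, e)" "q = (c', e')" by (cases p, cases q)
    have "e \<subseteq> verts G" "e' \<subseteq> verts G" using regular_subset[OF G] pq by auto
    then show "p = q" using inj_on_image_eq_iff[OF inj] pq(3) by simp
  qed
  have H: "regular_coloured {0..D} H" using isomorphic_regular[OF assms] .
  have "Phi0i i G \<le> Phi0i i H" for i
    unfolding Phi0i_def
  proof (rule card_inj_on_le)
    show "inj_on ((`) ?F) {C. alternating_cycle 0 i G C}"
    proof (rule inj_onI)
      fix C C' assume C: "C \<in> {C. alternating_cycle 0 i G C}" "C' \<in> {C. alternating_cycle 0 i G C}"
        "?F ` C = ?F ` C'"
      then have "C \<subseteq> edges G" "C' \<subseteq> edges G" unfolding alternating_cycle_def by simp_all
      then show "C = C'" using inj_on_image_eq_iff[OF injE] C(3) by simp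
    qed
    show "(`) ?F ` {C. alternating_cycle 0 i G C} \<subseteq> {C. alternating_cycle 0 i H C}"
      using isomorphic_alternating_cycle[OF E inj regular_subset[OF G]] by blast
  qed (rule finite_alternating_cycles[OF H])
  then show ?thesis unfolding Phi0_def by (intro sum_mono)
qed

text \<open>Paths are pushed forward by \<open>f\<close> and pulled back edge by edge, since by
  injectivity the image of an edge determines its endpoints.\<close>

lemma isomorphic_reach_iff:
  assumes f: "inj_on f (verts G)" and E: "edges H = (\<lambda>(c, e). (c, f ` e)) ` edges G"
    and sub: "\<forall>(c, e) \<in> edges G. e \<subseteq> verts G" and v: "v \<in> verts G"
  shows "{w. (adj H)\<^sup>*\<^sup>* (f v) w} = f ` {w. (adj G)\<^sup>*\<^sup>* v w}"
proof (intro equalityI subsetI)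
  fix w assume "w \<in> {w. (adj H)\<^sup>*\<^sup>* (f v) w}"
  then have "(adj H)\<^sup>*\<^sup>* (f v) w" by simp
  then show "w \<in> f ` {w. (adj G)\<^sup>*\<^sup>* v w}"
  proof (induction rule: rtranclp_induct)
    case (step y z)
    then obtain y' where y': "y = f y'" "(adj G)\<^sup>*\<^sup>* v y'" by blast
    have y'V: "y' \<in> verts G" using reach_verts[OF sub y'(2) v] .
    obtain c e where e: "(c, e) \<in> edges G" "f ` e = {y, z}"
      using step(2) unfolding adj_def E by auto
    have eV: "e \<subseteq> verts G" using sub e(1) by blast
    obtain z' where z': "z' \<in> e" "z = f z'" using e(2) by blast
    have "f ` e = f ` {y', z'}" using e(2) y' z' by simp
    moreover have yz: "{y', z'} \<subseteq> verts G" using y'V z'(1) eV by blast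
    ultimately have "e = {y', z'}" using inj_on_image_eq_iff[OF f eV yz] by simp
    then have "adj G y' z'" using e(1) unfolding adj_def by blast
    then show ?case using y'(2) z'(2) by (meson imageI mem_Collect_eq rtranclp.rtrancl_into_rtrancl)
  qed simp
next
  fix w assume "w \<in> f ` {w. (adj G)\<^sup>*\<^sup>* v w}"
  then obtain u where u: "w = f u" "(adj G)\<^sup>*\<^sup>* v u" by blast
  from u(2) have "(adj H)\<^sup>*\<^sup>* (f v) (f u)"
  proof (induction rule: rtranclp_induct)
    case (step y z)
    have "adj H (f y) (f z)" using step(2) unfolding adj_def E by force
    then show ?case using step(3) by simp
  qed simp
  then show "w \<in> {w. (adj H)\<^sup>*\<^sup>* (f v) w}" using u by simp
qed

lemma isomorphic_component_of:
  assumes f: "inj_on f (verts G)" and E: "edges H = (\<lambda>(c, e). (c, f ` e)) ` edges G"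
    and sub: "\<forall>(c, e) \<in> edges G. e \<subseteq> verts G" and v: "v \<in> verts G"
  shows "isomorphic (component_of G v) (component_of H (f v))"
proof -
  let ?R = "{w. (adj G)\<^sup>*\<^sup>* v w}"
  have R: "?R \<subseteq> verts G" using reach_verts[OF sub _ v] by blast
  have "f ` e \<subseteq> f ` ?R \<longleftrightarrow> e \<subseteq> ?R" if "(c, e) \<in> edges G" for c e
  proof -
    have "e \<subseteq> verts G" using sub that by blast
    then show ?thesis using inj_on_image_mem_iff[OF f _ R] by blast
  qed
  then have "edges (component_of H (f v)) = (\<lambda>(c, e). (c, f ` e)) ` edges (component_of G v)"
    unfolding component_of_def isomorphic_reach_iff[OF assms] E by force
  moreover have "bij_betw f ?R (f ` ?R)"
    using inj_on_subset[OF f R] by (rule inj_on_imp_bij_betw)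
  ultimately show ?thesis
    unfolding isomorphic_def
    by (intro exI[of _ f]) (simp add: component_of_def isomorphic_reach_iff[OF assms])
qed

text \<open>Allows graphs to be moved to disjoint vertex sets without leaving the class. After
  deletion of colour 0, every component of \<open>H\<close> is the image of a component of
  \<open>G\<close>, hence still a copy of \<open>B\<close>.\<close>

lemma isomorphic_labelled:
  fixes G H :: "nat cgraph"
  assumes iso: "isomorphic G H" and G: "G \<in> labelled_graphs D B"
  shows "H \<in> labelled_graphs D B"
proof -
  obtain f where f: "bij_betw f (verts G) (verts H)"
    and E: "edges H = (\<lambda>(c, e). (c, f ` e)) ` edges G"
    using iso unfolding isomorphic_def by blast
  let ?d = "delete_colour 0"
  have R: "regular_coloured {0..D} G" "connected_graph G"
    and GB: "\<And>K. K \<in> components (?d G) \<Longrightarrow> isomorphic K B"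
    using G unfolding labelled_graphs_def by auto
  have Ed: "edges (?d H) = (\<lambda>(c, e). (c, f ` e)) ` edges (?d G)"
    unfolding delete_colour_def E by force
  have fd: "inj_on f (verts (?d G))" and V: "verts (?d H) = f ` verts (?d G)"
    using f by (auto simp: delete_colour_def bij_betw_def)
  have sub: "\<forall>(c, e) \<in> edges (?d G). e \<subseteq> verts (?d G)"
    using regular_subset[OF R(1)] by (auto simp: delete_colour_def)
  have "isomorphic K B" if K: "K \<in> components (?d H)" for K
  proof -
    obtain v where v: "v \<in> verts (?d G)" "K = component_of (?d H) (f v)"
      using K V unfolding components_def by auto
    have "isomorphic (component_of (?d G) v) K"
      unfolding v(2) by (rule isomorphic_component_of[OF fd Ed sub v(1)])
    moreover have "\<forall>(c, e) \<in> edges (component_of (?d G) v). e \<subseteq> verts (component_of (?d G) v)"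
      unfolding component_of_def by auto
    ultimately have "isomorphic K (component_of (?d G) v)" by (rule isomorphic_sym)
    moreover have "isomorphic (component_of (?d G) v) B"
      using GB v(1) unfolding components_def by blast
    ultimately show ?thesis by (rule isomorphic_trans)
  qed
  then show ?thesis
    using isomorphic_regular[OF iso R(1)] isomorphic_connected[OF iso R(2)]
    unfolding labelled_graphs_def by blast
qed

section \<open>Gluing two graphs along edges of colour 0\<close>

text \<open>A path from a vertex of \<open>G\<close> cannot leave \<open>G\<close>, as the edges of
  \<open>H\<close> lie in the disjoint set \<open>verts H\<close>. The condition
  \<open>e \<noteq> {}\<close> rules out empty edges of \<open>H\<close>, which would lie inside
  every component.\<close>

lemma component_of_disjoint_union:
  assumes G: "\<forall>(c, e) \<in> edges G. e \<subseteq> verts G" and H: "\<forall>(c, e) \<in> edges H. e \<subseteq> verts H \<and> e \<noteq> {}"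
    and disj: "verts G \<inter> verts H = {}" and U: "edges U = edges G \<union> edges H"
    and v: "v \<in> verts G"
  shows "component_of U v = component_of G v"
proof -
  have "(adj G)\<^sup>*\<^sup>* v w" if "(adj U)\<^sup>*\<^sup>* v w" for w
    using that
  proof (induction rule: rtranclp_induct)
    case (step y z)
    have "y \<in> verts G" using reach_verts[OF G step(3) v] .
    then have "adj G y z" using step(2) H disj unfolding adj_def U by blast
    then show ?case using step(3) by simp
  qed simp
  moreover have "adj G \<le> adj U" by (auto simp: adj_def U)
  then have "(adj G)\<^sup>*\<^sup>* \<le> (adj U)\<^sup>*\<^sup>*" by (rule rtranclp_mono)
  ultimately have R: "{w. (adj U)\<^sup>*\<^sup>* v w} = {w. (adj G)\<^sup>*\<^sup>* v w}" by blast
  have "{w. (adj G)\<^sup>*\<^sup>* v w} \<subseteq> verts G" using reach_verts[OF G _ v] by blast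
  moreover have "(c, e) \<in> edges G" if "(c, e) \<in> edges U" "e \<subseteq> verts G" for c e
  proof (rule ccontr)
    assume "(c, e) \<notin> edges G"
    then have "e \<subseteq> verts H" "e \<noteq> {}" using that(1) H unfolding U by auto
    then show False using that(2) disj by blast
  qed
  ultimately have "(c, e) \<in> edges U \<and> e \<subseteq> {w. (adj G)\<^sup>*\<^sup>* v w} \<longleftrightarrow>
      (c, e) \<in> edges G \<and> e \<subseteq> {w. (adj G)\<^sup>*\<^sup>* v w}" for c e
    using U by (metis Un_iff subset_trans)
  then have "{(c, e) \<in> edges U. e \<subseteq> {w. (adj G)\<^sup>*\<^sup>* v w}} =
      {(c, e) \<in> edges G. e \<subseteq> {w. (adj G)\<^sup>*\<^sup>* v w}}"
    by blast
  then show ?thesis unfolding component_of_def R by simp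
qed

text \<open>A switch of two edges of colour 0 in the union of \<open>G\<close> and \<open>H\<close>.
  The order of the ends selects the pairing: exchanging \<open>c\<close> and \<open>d\<close> gives
  the other one.\<close>

definition glued :: "'v cgraph \<Rightarrow> 'v cgraph \<Rightarrow> 'v \<Rightarrow> 'v \<Rightarrow> 'v \<Rightarrow> 'v \<Rightarrow> 'v cgraph" where
  "glued G H a b c d =
     \<lparr>verts = verts G \<union> verts H,
      edges = (edges G - {(0, {a, b})}) \<union> (edges H - {(0, {c, d})}) \<union> {(0, {a, c}), (0, {b, d})}\<rparr>"

text \<open>Together with \<open>commuted\<close>, this symmetry lets each fact about the side of
  \<open>G\<close> be reused for the side of \<open>H\<close>.\<close>

lemma glued_commute: "glued H G c d a b = glued G H a b c d"
proof -
  have "{c, a} = {a, c}" "{d, b} = {b, d}" by auto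
  then show ?thesis by (simp add: glued_def Un_ac)
qed

locale gluing =
  fixes D :: nat and G H :: "'v cgraph" and a b c d :: 'v
  assumes D: "1 \<le> D"
    and G: "regular_coloured {0..D} G" "connected_graph G"
    and H: "regular_coloured {0..D} H" "connected_graph H"
    and disj: "verts G \<inter> verts H = {}"
    and ab: "(0, {a, b}) \<in> edges G" and cd: "(0, {c, d}) \<in> edges H"
begin

abbreviation "U \<equiv> glued G H a b c d"

lemma commuted: "gluing D H G c d a b"
  using D G H disj ab cd by unfold_locales (simp_all add: Int_commute)

lemma ends: "a \<in> verts G" "b \<in> verts G" "c \<in> verts H" "d \<in> verts H" "a \<noteq> b" "c \<noteq> d"
  using regular_colouredD(3,4)[OF G(1) ab] regular_colouredD(3,4)[OF H(1) cd]
  by (auto simp: card_2_iff)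

text \<open>Only the edges of colour 0 at \<open>a\<close> and \<open>b\<close> are replaced, by
  \<open>{a, c}\<close> and \<open>{b, d}\<close>, and no edge of \<open>H\<close> contains a vertex
  of \<open>G\<close>.\<close>

lemma unique_edge:
  assumes v: "v \<in> verts G" and k: "k \<in> {0..D}"
  shows "\<exists>!e. (k, e) \<in> edges U \<and> v \<in> e"
proof -
  obtain e0 where e0: "(k, e0) \<in> edges G" "v \<in> e0"
    and u: "\<And>e. (k, e) \<in> edges G \<Longrightarrow> v \<in> e \<Longrightarrow> e = e0"
    using regular_colouredD(5)[OF G(1) v k] by auto
  have nH: "v \<notin> e" if "(k', e) \<in> edges H" for k' e
    using regular_colouredD(3)[OF H(1) that] v disj by blast
  have ne: "v \<noteq> c" "v \<noteq> d" using v ends disj by auto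
  define e1 where
    "e1 = (if k = 0 \<and> v = a then {a, c} else if k = 0 \<and> v = b then {b, d} else e0)"
  have "(k, e) \<in> edges U \<and> v \<in> e \<longleftrightarrow> e = e1" for e
  proof (cases "k = 0 \<and> v \<in> {a, b}")
    case True
    then have "e0 = {a, b}" using u[of "{a, b}"] ab by auto
    then show ?thesis
      using True u[of e] nH[of k e] ne ends(5) by (auto simp: glued_def e1_def)
  next
    case False
    then have "(k, e0) \<noteq> (0, {a, b})" using e0(2) by auto
    then show ?thesis
      using False u[of e] nH[of k e] ne e0 by (auto simp: glued_def e1_def)
  qed
  then show ?thesis by auto
qed

lemma regular_glued: "regular_coloured {0..D} U"
proof -
  interpret comm: gluing D H G c d a b by (rule commuted)
  have "\<exists>!e. (k, e) \<in> edges U \<and> v \<in> e" if v: "v \<in> verts U" and k: "k \<in> {0..D}" for v k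
  proof (cases "v \<in> verts G")
    case True
    then show ?thesis using k by (rule unique_edge)
  next
    case False
    then have "v \<in> verts H" using v by (simp add: glued_def)
    then show ?thesis using comm.unique_edge[OF _ k] by (simp only: glued_commute[of H G c d a b])
  qed
  moreover have "k \<in> {0..D} \<and> e \<subseteq> verts U \<and> card e = 2" if "(k, e) \<in> edges U" for k e
  proof -
    note kU = that
    consider "(k, e) \<in> edges G" | "(k, e) \<in> edges H" | "k = 0" "e = {a, c} \<or> e = {b, d}"
      using kU by (auto simp: glued_def)
    then show ?thesis
    proof cases
      case 1
      then show ?thesis using regular_colouredD(2-4)[OF G(1) 1] by (auto simp: glued_def)
    next
      case 2
      then show ?thesis using regular_colouredD(2-4)[OF H(1) 2] by (auto simp: glued_def)
    next
      case 3
      moreover have "a \<noteq> c" "b \<noteq> d" using ends disj by auto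
      ultimately show ?thesis using ends by (auto simp: glued_def)
    qed
  qed
  moreover have "finite (verts U)"
    using regular_colouredD(1)[OF G(1)] regular_colouredD(1)[OF H(1)] by (simp add: glued_def)
  ultimately show ?thesis unfolding regular_coloured_def by blast
qed

lemma adj_glued:
  assumes "(k, {y, z}) \<in> edges G" "(k, {y, z}) \<noteq> (0, {a, b})"
  shows "adj U y z"
proof -
  have "(k, {y, z}) \<in> edges U" using assms by (simp add: glued_def)
  then show ?thesis unfolding adj_def by blast
qed

text \<open>The edge {a, b} is not a bridge: it lies on an alternating cycle.\<close>

lemma reach_glued_ab: "(adj U)\<^sup>*\<^sup>* b a"
proof -
  have col: "0 \<in> {0..D}" "1 \<in> {0..D}" using D by auto
  obtain n x where n: "0 < n" "even n" "inj_on x {..<n}" "x 0 = a"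
    and e: "\<And>t. t < n \<Longrightarrow> (if even t then 0::nat else 1, {x t, x (Suc t mod n)}) \<in> edges G"
    using alternating_walk_exists[OF G(1) col ends(1)] by metis
  have n2: "2 \<le> n" using n(1,2) by (auto elim!: evenE)
  \<comment> \<open>The closed walk with colours 0 and 1 starts at \<open>a\<close>, so its first
    edge is the cut edge; the rest of it leads from \<open>b\<close> back to
    \<open>a\<close>.\<close>
  have "{a, x 1} = {a, b}"
    by (rule regular_coloured_edge_unique[OF G(1) _ ab, of _ a]) (use e[of 0] n n2 in auto)
  then have x1: "x 1 = b" by (auto simp: doubleton_eq_iff)
  have step: "adj U (x t) (x (Suc t mod n))" if t: "0 < t" "t < n" for t
  proof -
    \<comment> \<open>Odd steps have colour 1, and an even step after the first starts at a vertex
      other than \<open>a\<close> and \<open>b\<close>, so none of them is the cut edge.\<close>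
    have "x t \<noteq> x 0 \<and> x t \<noteq> x 1" if "even t"
    proof -
      have "t \<noteq> 1" using that by auto
      then show ?thesis
        using t n2 inj_on_eq_iff[OF n(3), of t 0] inj_on_eq_iff[OF n(3), of t 1] by simp
    qed
    then have "(if even t then 0::nat else 1, {x t, x (Suc t mod n)}) \<noteq> (0, {a, b})"
      using n(4) x1 by (auto simp: doubleton_eq_iff)
    then show ?thesis by (rule adj_glued[OF e[OF t(2)]])
  qed
  have "(adj U)\<^sup>*\<^sup>* b (x (Suc t))" if "Suc t < n" for t
    using that
  proof (induction t)
    case (Suc t)
    then show ?case using step[of "Suc t"] by (auto intro: rtranclp.rtrancl_into_rtrancl)
  qed (use x1 in simp)
  \<comment> \<open>Index \<open>n - 2\<close> leads to the last vertex \<open>x (n - 1)\<close>,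
    whose step closes up at \<open>x 0 = a\<close> modulo \<open>n\<close>.\<close>
  from this[of "n - 2"] have "(adj U)\<^sup>*\<^sup>* b (x (n - 1))"
    using n2 by (simp add: Suc_diff_Suc numeral_2_eq_2)
  then show ?thesis using step[of "n - 1"] n n2 by (auto intro: rtranclp.rtrancl_into_rtrancl)
qed

text \<open>Wherever a path uses the cut edge, \<open>reach_glued_ab\<close> supplies a detour
  between its ends.\<close>

lemma reach_glued: "(adj G)\<^sup>*\<^sup>* u v \<Longrightarrow> (adj U)\<^sup>*\<^sup>* u v"
proof (induction rule: rtranclp_induct)
  case (step y z)
  obtain k where k: "(k, {y, z}) \<in> edges G" using step(2) unfolding adj_def by blast
  have "(adj U)\<^sup>*\<^sup>* y z"
  proof (cases "(k, {y, z}) = (0, {a, b})")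
    case True
    then show ?thesis
      using reach_glued_ab reach_sym[OF reach_glued_ab] by (auto simp: doubleton_eq_iff)
  next
    case False
    then have "adj U y z" by (rule adj_glued[OF k])
    then show ?thesis by simp
  qed
  then show ?case using step(3) by simp
qed simp

text \<open>Every vertex is joined to \<open>a\<close>: those of \<open>G\<close> by
  \<open>reach_glued\<close>, those of \<open>H\<close> through \<open>c\<close> and the new edge
  \<open>{a, c}\<close>.\<close>

lemma connected_glued: "connected_graph U"
proof -
  interpret comm: gluing D H G c d a b by (rule commuted)
  have "adj U a c" unfolding adj_def glued_def by auto
  then have ca: "(adj U)\<^sup>*\<^sup>* c a" by (blast intro: adj_sym)
  have "(adj U)\<^sup>*\<^sup>* u a" if "u \<in> verts U" for u
  proof (cases "u \<in> verts G")
    case True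
    then show ?thesis using reach_glued G(2) ends unfolding connected_graph_def by blast
  next
    case False
    then have "(adj H)\<^sup>*\<^sup>* u c"
      using that H(2) ends unfolding connected_graph_def by (auto simp: glued_def)
    then have "(adj U)\<^sup>*\<^sup>* u c"
      using comm.reach_glued glued_commute[of H G c d a b] by simp
    then show ?thesis using ca by simp
  qed
  then have "(adj U)\<^sup>*\<^sup>* u v" if "u \<in> verts U" "v \<in> verts U" for u v
    using that reach_sym[of U v a] rtranclp_trans[of "adj U" u a v] by blast
  moreover have "verts U \<noteq> {}" using ends by (auto simp: glued_def)
  ultimately show ?thesis unfolding connected_graph_def by blast
qed

text \<open>Gluing changes only edges of colour 0, so after their deletion the glued graph is the
  disjoint union of the two parts.\<close>

lemma component_of_glued:
  assumes v: "v \<in> verts G"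
  shows "component_of (delete_colour 0 U) v = component_of (delete_colour 0 G) v"
proof (rule component_of_disjoint_union)
  show "\<forall>(c, e) \<in> edges (delete_colour 0 G). e \<subseteq> verts (delete_colour 0 G)"
    using regular_subset[OF G(1)] by (auto simp: delete_colour_def)
  show "\<forall>(c, e) \<in> edges (delete_colour 0 H). e \<subseteq> verts (delete_colour 0 H) \<and> e \<noteq> {}"
    using regular_colouredD(3,4)[OF H(1)] by (fastforce simp: delete_colour_def)
  show "edges (delete_colour 0 U) = edges (delete_colour 0 G) \<union> edges (delete_colour 0 H)"
    by (auto simp: delete_colour_def glued_def)
qed (use disj v in \<open>auto simp: delete_colour_def\<close>)

lemma components_glued:
  "components (delete_colour 0 U) = components (delete_colour 0 G) \<union> components (delete_colour 0 H)"
proof -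
  interpret comm: gluing D H G c d a b by (rule commuted)
  have "component_of (delete_colour 0 U) ` (verts G \<union> verts H) =
      component_of (delete_colour 0 G) ` verts G \<union> component_of (delete_colour 0 H) ` verts H"
    using component_of_glued comm.component_of_glued
    unfolding image_Un glued_commute[of H G c d a b] by simp
  then show ?thesis by (simp add: components_def delete_colour_def glued_def)
qed

text \<open>Alternating cycles of the same two colours that share a vertex coincide, so at most one
  passes through the cut edge.\<close>

lemma card_cycles_avoiding:
  assumes i: "i \<in> {1..D}"
  shows "Phi0i i G \<le> card {C. alternating_cycle 0 i G C \<and> (0, {a, b}) \<notin> C} + 1"
proof -
  let ?A = "{C. alternating_cycle 0 i G C \<and> (0, {a, b}) \<notin> C}"
  let ?B = "{C. alternating_cycle 0 i G C \<and> (0, {a, b}) \<in> C}"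
  have fin: "finite {C. alternating_cycle 0 i G C}" by (rule finite_alternating_cycles[OF G(1)])
  have col: "0 \<in> {0..D}" "i \<in> {0..D}" using i by auto
  have "C = C'" if "C \<in> ?B" "C' \<in> ?B" for C C'
  proof -
    have "a \<in> \<Union> (snd ` C)" "a \<in> \<Union> (snd ` C')" using that by force+
    then show ?thesis using alternating_cycle_eq[OF G(1) col] that by blast
  qed
  then have "card ?B \<le> 1"
    using fin by (auto simp: card_le_Suc0_iff_eq)
  moreover have "{C. alternating_cycle 0 i G C} = ?A \<union> ?B" by blast
  then have "Phi0i i G \<le> card ?A + card ?B"
    unfolding Phi0i_def by (simp only: card_Un_le)
  ultimately show ?thesis by simp
qed

text \<open>Cycles avoiding the two cut edges survive, and the two cycles through them merge into one.
  Hence equality holds, but the inequality suffices.\<close>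

lemma Phi0i_glued:
  assumes i: "i \<in> {1..D}"
  shows "Phi0i i G + Phi0i i H \<le> Phi0i i U + 1"
proof -
  interpret comm: gluing D H G c d a b by (rule commuted)
  let ?A = "{C. alternating_cycle 0 i G C \<and> (0, {a, b}) \<notin> C}"
  let ?B = "{C. alternating_cycle 0 i H C \<and> (0, {c, d}) \<notin> C}"
  have col: "0 \<in> {0..D}" "i \<in> {0..D}" using i by auto
  have aU: "a \<in> verts U" using ends by (simp add: glued_def)
  \<comment> \<open>The merged cycle, taken as the alternating cycle of the glued graph through
    \<open>a\<close>. It contains the new edge \<open>{a, c}\<close> and is therefore distinct from
    all cycles of \<open>G\<close> and \<open>H\<close>.\<close>
  obtain C where C: "alternating_cycle 0 i U C" "a \<in> \<Union> (snd ` C)"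
    using alternating_cycle_exists[OF regular_glued col aU] .
  have ac: "(0, {a, c}) \<in> C"
    by (rule alternating_cycle_closed[OF regular_glued col C]) (auto simp: glued_def)
  have nG: "(0, {a, c}) \<notin> edges G" and nH: "(0, {a, c}) \<notin> edges H"
    using regular_colouredD(3)[OF G(1)] regular_colouredD(3)[OF H(1)] ends disj by blast+
  have EGH: "edges G \<inter> edges H = {}"
  proof -
    have "False" if "(k, e) \<in> edges G" "(k, e) \<in> edges H" for k e
    proof -
      have "e \<subseteq> {}" using regular_colouredD(3)[OF G(1)] regular_colouredD(3)[OF H(1)] that disj by blast
      then show False using regular_colouredD(4)[OF G(1) that(1)] by simp
    qed
    then show ?thesis by auto
  qed
  have fin: "finite ?A" "finite ?B"
    using finite_alternating_cycles[OF G(1)] finite_alternating_cycles[OF H(1)]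
    by (auto intro: rev_finite_subset)
  have sub: "C' \<in> ?A \<Longrightarrow> C' \<subseteq> edges G" "C' \<in> ?B \<Longrightarrow> C' \<subseteq> edges H" for C'
    unfolding alternating_cycle_def by simp_all
  have ne: "C' \<noteq> {}" if "alternating_cycle 0 i K C'" for K :: "'v cgraph" and C'
    by (rule alternating_cycle_closed_walk[OF that]) auto
  \<comment> \<open>A common cycle would lie in the disjoint edge sets of both graphs and be empty,
    whereas an alternating cycle has at least one edge.\<close>
  have "?A \<inter> ?B = {}"
  proof (rule ccontr)
    assume "?A \<inter> ?B \<noteq> {}"
    then obtain C' where C': "C' \<in> ?A" "C' \<in> ?B" by blast
    then have "C' = {}" using sub[of C'] EGH by blast
    then show False using ne C'(1) by blast
  qed
  moreover have "C \<notin> ?A \<union> ?B" using sub ac nG nH by blast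
  ultimately have "card (insert C (?A \<union> ?B)) = Suc (card ?A + card ?B)"
    using fin by (simp add: card_Un_disjoint)
  moreover have "insert C (?A \<union> ?B) \<subseteq> {C. alternating_cycle 0 i U C}"
  proof (intro insert_subsetI subsetI)
    show "C \<in> {C. alternating_cycle 0 i U C}" using C by simp
    fix C' assume C': "C' \<in> ?A \<union> ?B"
    then have "C' \<subseteq> edges U" using sub[of C'] unfolding glued_def by auto
    then show "C' \<in> {C. alternating_cycle 0 i U C}"
      using C' unfolding alternating_cycle_def by blast
  qed
  then have "card (insert C (?A \<union> ?B)) \<le> Phi0i i U"
    unfolding Phi0i_def by (rule card_mono[OF finite_alternating_cycles[OF regular_glued]])
  ultimately show ?thesis
    using card_cycles_avoiding[OF i] comm.card_cycles_avoiding[OF i] by simp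
qed

lemma Phi0_glued: "Phi0 D G + Phi0 D H \<le> Phi0 D U + D"
proof -
  have "(\<Sum>i=1..D. Phi0i i G + Phi0i i H) \<le> (\<Sum>i=1..D. Phi0i i U + 1)"
    using Phi0i_glued by (rule sum_mono)
  then show ?thesis unfolding Phi0_def sum.distrib by simp
qed

end

section \<open>Gluing within the graphs built from a fixed bubble\<close>

lemma isomorphic_relabel:
  assumes "inj_on f (verts G)"
  shows "isomorphic G \<lparr>verts = f ` verts G, edges = (\<lambda>(c, e). (c, f ` e)) ` edges G\<rparr>"
  unfolding isomorphic_def using assms by (auto simp: bij_betw_def)

lemma bubble_card_pos:
  assumes "bubble D B"
  shows "0 < card (verts B)"
  using assms unfolding bubble_def regular_coloured_def connected_graph_def
  by (simp add: card_gt_0_iff)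

text \<open>The number of bubbles is read off from the number of vertices, which is a multiple of
  the positive number \<open>card (verts B)\<close>.\<close>

lemma isomorphic_num_bubbles:
  fixes G H :: "nat cgraph"
  assumes B: "bubble D B" and G: "G \<in> labelled_graphs D B" and iso: "isomorphic G H"
  shows "num_bubbles H = num_bubbles G"
  using card_verts_labelled[OF G] card_verts_labelled[OF isomorphic_labelled[OF iso G]]
    isomorphic_card[OF iso] bubble_card_pos[OF B] by simp

lemma num_bubbles_pos:
  assumes "G \<in> labelled_graphs D B"
  shows "0 < num_bubbles G"
proof -
  have "finite (verts G)" "verts G \<noteq> {}"
    using assms unfolding labelled_graphs_def regular_coloured_def connected_graph_def by auto
  then show ?thesis using card_verts_labelled[OF assms] by (intro gr0I) auto
qed

text \<open>Subadditivity of the degree: the conclusion gives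
  \<open>delta D a K \<le> delta D a G + delta D a H\<close> for every \<open>a\<close>.\<close>

lemma glued_labelled_exists:
  assumes D: "1 \<le> D" and B: "bubble D B"
    and G: "G \<in> labelled_graphs D B" and H: "H \<in> labelled_graphs D B"
  obtains K where "K \<in> labelled_graphs D B" "num_bubbles K = num_bubbles G + num_bubbles H"
    "Phi0 D G + Phi0 D H \<le> Phi0 D K + D"
proof -
  \<comment> \<open>Copies on the even and on the odd numbers have disjoint vertex sets.\<close>
  let ?f = "\<lambda>n::nat. 2 * n" and ?g = "\<lambda>n::nat. 2 * n + 1"
  define G' where "G' = \<lparr>verts = ?f ` verts G, edges = (\<lambda>(c, e). (c, ?f ` e)) ` edges G\<rparr>"
  define H' where "H' = \<lparr>verts = ?g ` verts H, edges = (\<lambda>(c, e). (c, ?g ` e)) ` edges H\<rparr>"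
  have iso: "isomorphic G G'" "isomorphic H H'"
    unfolding G'_def H'_def by (auto intro!: isomorphic_relabel inj_onI)
  have L: "G' \<in> labelled_graphs D B" "H' \<in> labelled_graphs D B"
    using isomorphic_labelled iso G H by blast+
  have disj: "verts G' \<inter> verts H' = {}"
    unfolding G'_def H'_def by (auto, presburger)
  have R: "regular_coloured {0..D} G'" "connected_graph G'"
    "regular_coloured {0..D} H'" "connected_graph H'"
    using L unfolding labelled_graphs_def by auto
  have zero: "0 \<in> {0..D}" by simp
  obtain a where a: "a \<in> verts G'" using R(2) unfolding connected_graph_def by blast
  obtain c where c: "c \<in> verts H'" using R(4) unfolding connected_graph_def by blast
  obtain b where b: "(0, {a, b}) \<in> edges G'"
    using regular_coloured_neighbour[OF R(1) a zero] by blast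
  obtain d where d: "(0, {c, d}) \<in> edges H'"
    using regular_coloured_neighbour[OF R(3) c zero] by blast
  let ?U = "glued G' H' a b c d"
  interpret sum: gluing D G' H' a b c d
    using D R disj b d by unfold_locales
  have K: "?U \<in> labelled_graphs D B"
    using sum.regular_glued sum.connected_glued sum.components_glued L unfolding labelled_graphs_def by auto
  have "card (verts ?U) = card (verts G') + card (verts H')"
    using regular_colouredD(1)[OF R(1)] regular_colouredD(1)[OF R(3)] disj
    by (simp add: glued_def card_Un_disjoint)
  \<comment> \<open>Vertex counts add up, and cancelling \<open>card (verts B)\<close> gives the
    same for the bubbles.\<close>
  then have "num_bubbles ?U = num_bubbles G' + num_bubbles H'"
    using card_verts_labelled[OF K] card_verts_labelled[OF L(1)] card_verts_labelled[OF L(2)]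
      bubble_card_pos[OF B] by (simp flip: add_mult_distrib)
  then have "num_bubbles ?U = num_bubbles G + num_bubbles H"
    using isomorphic_num_bubbles[OF B G iso(1)] isomorphic_num_bubbles[OF B H iso(2)] by simp
  moreover have "Phi0 D G \<le> Phi0 D G'" "Phi0 D H \<le> Phi0 D H'"
    using isomorphic_Phi0_le[OF iso(1)] isomorphic_Phi0_le[OF iso(2)] G H
    unfolding labelled_graphs_def by auto
  then have "Phi0 D G + Phi0 D H \<le> Phi0 D ?U + D" using sum.Phi0_glued by linarith
  ultimately show thesis using that K by blast
qed

text \<open>Passes from a labelled graph to an element of \<open>tildeG\<close> without raising the
  degree.\<close>

lemma isomorphic_labelled_representative:
  assumes B: "bubble D B" and G: "G \<in> labelled_graphs D B"
  obtains K where "K \<in> tildeG D B" "num_bubbles K = num_bubbles G" "Phi0 D G \<le> Phi0 D K"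
proof -
  obtain K where K: "K \<in> tildeG D B" "isomorphic G K"
    using tildeG_representative[OF G] by blast
  have "regular_coloured {0..D} G" using G unfolding labelled_graphs_def by blast
  then show thesis
    using that[OF K(1)] isomorphic_num_bubbles[OF B G K(2)] isomorphic_Phi0_le[OF K(2)] by blast
qed

section \<open>Uniqueness of the parameter and graphs of order 0\<close>

lemma delta_alphaM_nonneg:
  assumes "G \<in> tildeG D B"
  shows "0 \<le> delta D (alphaM D B) G"
proof -
  have "(real (Phi0 D G) - real D) / real (num_bubbles G) \<le> alphaM D B"
    unfolding alphaM_def using bdd_above_alphaM assms by (rule cSUP_upper2) simp
  moreover have "0 < num_bubbles G" using num_bubbles_pos assms tildeG_subset by blast
  ultimately show ?thesis by (simp add: delta_def pos_divide_le_eq)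
qed

text \<open>Gluing copies of \<open>G\<close> one after another gives degree at most 0 with
  arbitrarily many bubbles, and nonnegativity forces degree 0 for the representatives. A finite
  order would bound the number of bubbles.\<close>

lemma infinite_order_zero:
  assumes D: "1 \<le> D" and B: "bubble D B" and G: "G \<in> tildeG D B" "delta D (alphaM D B) G = 0"
  shows "infinite (order_contributions D B (alphaM D B) 0)"
proof
  assume fin: "finite (order_contributions D B (alphaM D B) 0)"
  have L: "G \<in> labelled_graphs D B" using G(1) tildeG_subset by blast
  have ex: "\<exists>K \<in> labelled_graphs D B. n < num_bubbles K \<and> delta D (alphaM D B) K \<le> 0" for n
  proof (induction n)
    case 0
    then show ?case using L num_bubbles_pos[OF L] G(2) by (intro bexI[of _ G]) auto
  next
    case (Suc n)
    then obtain K where K: "K \<in> labelled_graphs D B" "n < num_bubbles K"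
      "delta D (alphaM D B) K \<le> 0" by blast
    obtain M where M: "M \<in> labelled_graphs D B" "num_bubbles M = num_bubbles K + num_bubbles G"
      "Phi0 D K + Phi0 D G \<le> Phi0 D M + D"
      using glued_labelled_exists[OF D B K(1) L] .
    have "real (Phi0 D K) + real (Phi0 D G) \<le> real (Phi0 D M) + real D"
      using M(3) by (simp flip: of_nat_add)
    then have "delta D (alphaM D B) M \<le> delta D (alphaM D B) K + delta D (alphaM D B) G"
      by (simp add: delta_def M(2) distrib_left)
    then show ?case
      using M(1,2) K(2,3) G(2) num_bubbles_pos[OF L] by (intro bexI[of _ M]) auto
  qed
  \<comment> \<open>A bound for the number of bubbles at order 0; inserting 0 keeps the set under
    \<open>Max\<close> nonempty.\<close>
  define m where "m = Max (insert 0 (num_bubbles ` order_contributions D B (alphaM D B) 0))"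
  obtain M where M: "M \<in> labelled_graphs D B" "m < num_bubbles M" "delta D (alphaM D B) M \<le> 0"
    using ex by blast
  obtain K where K: "K \<in> tildeG D B" "num_bubbles K = num_bubbles M" "Phi0 D M \<le> Phi0 D K"
    using isomorphic_labelled_representative[OF B M(1)] .
  have "delta D (alphaM D B) K \<le> delta D (alphaM D B) M"
    using K by (simp add: delta_def)
  then have "delta D (alphaM D B) K = 0"
    using delta_alphaM_nonneg[OF K(1)] M(3) by simp
  then have "num_bubbles K \<le> m"
    unfolding m_def using fin K(1) by (intro Max_ge) (auto simp: order_contributions_def)
  then show False using M(2) K(2) by simp
qed

text \<open>Nonnegativity makes \<open>a\<close> an upper bound of the quotients, so only
  \<open>alphaM D B < a\<close> has to be excluded.\<close>

lemma nonneg_nontrivial_eq_alphaM: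
  assumes D: "1 \<le> D" and B: "bubble D B"
    and nonneg: "nonneg_rational D B a" and nontriv: "nontrivial D B a"
  shows "a = alphaM D B"
proof (rule ccontr)
  assume "a \<noteq> alphaM D B"
  moreover have "alphaM D B \<le> a"
    unfolding alphaM_def
  proof (rule cSUP_least[OF tildeG_nonempty[OF D B]])
    fix G assume G: "G \<in> tildeG D B"
    then have "0 < num_bubbles G" using num_bubbles_pos tildeG_subset by blast
    moreover have "0 \<le> delta D a G" using nonneg G unfolding nonneg_rational_def by blast
    ultimately show "(real (Phi0 D G) - real D) / real (num_bubbles G) \<le> a"
      by (simp add: delta_def pos_divide_le_eq)
  qed
  ultimately have less: "0 < a - alphaM D B" by simp
  obtain k where k: "infinite (order_contributions D B a k)"
    using nontriv unfolding nontrivial_def by blast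
  \<comment> \<open>As \<open>delta D a G\<close> exceeds the nonnegative degree at
    \<open>alphaM D B\<close> by \<open>num_bubbles G * (a - alphaM D B)\<close>, degree
    \<open>k\<close> leaves at most \<open>m\<close> bubbles, and each number of bubbles admits
    finitely many graphs.\<close>
  define m where "m = nat \<lceil>k / (a - alphaM D B)\<rceil>"
  have "order_contributions D B a k \<subseteq> (\<Union>n\<le>m. {G \<in> tildeG D B. num_bubbles G = n})"
  proof
    fix G assume "G \<in> order_contributions D B a k"
    then have G: "G \<in> tildeG D B" "delta D a G = k" unfolding order_contributions_def by auto
    have "delta D a G = delta D (alphaM D B) G + real (num_bubbles G) * (a - alphaM D B)"
      by (simp add: delta_def algebra_simps)
    then have "real (num_bubbles G) * (a - alphaM D B) \<le> k"
      using delta_alphaM_nonneg[OF G(1)] G(2) by simp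
    then have "real (num_bubbles G) \<le> k / (a - alphaM D B)"
      using less by (simp add: pos_le_divide_eq)
    then have "num_bubbles G \<le> m" unfolding m_def by linarith
    then show "G \<in> (\<Union>n\<le>m. {G \<in> tildeG D B. num_bubbles G = n})" using G(1) by simp
  qed
  moreover have "finite (\<Union>n\<le>m. {G \<in> tildeG D B. num_bubbles G = n})"
    using finite_num_bubbles by blast
  ultimately show False using k finite_subset by blast
qed

section \<open>Limit of the rescaled free energy\<close>

text \<open>Division by \<open>N ^ D\<close> leaves
  \<open>c G * N powr (- delta D (alphaM D B) G)\<close>, whose exponent is never positive.\<close>

lemma contribution_tendsto:
  assumes G: "G \<in> tildeG D B"
  shows "((\<lambda>N. contribution D B c N G / N ^ D) \<longlongrightarrow>
    (if delta D (alphaM D B) G = 0 then c G else 0)) at_top"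
proof -
  let ?\<delta> = "delta D (alphaM D B) G"
  have "((\<lambda>N. c G * N powr (- ?\<delta>)) \<longlongrightarrow> (if ?\<delta> = 0 then c G else 0)) at_top"
  proof (cases "?\<delta> = 0")
    \<comment> \<open>The power is 1 only away from \<open>N = 0\<close>, because
      \<open>0 powr 0 = 0\<close>; hence the equality is claimed for large \<open>N\<close>.\<close>
    case True
    have "\<forall>\<^sub>F N :: real in at_top. c G = c G * N powr (- ?\<delta>)"
      using eventually_gt_at_top[of 0] by eventually_elim (simp add: True)
    then show ?thesis using True by (auto intro: Lim_transform_eventually[OF tendsto_const])
  next
    case False
    then have "- ?\<delta> < 0" using delta_alphaM_nonneg[OF G] by simp
    then have "((\<lambda>N. N powr (- ?\<delta>)) \<longlongrightarrow> 0) at_top"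
      using filterlim_ident by (rule tendsto_neg_powr)
    then show ?thesis using False tendsto_mult_right_zero by auto
  qed
  moreover have "\<forall>\<^sub>F N :: real in at_top.
      c G * N powr (- ?\<delta>) = contribution D B c N G / N ^ D"
    using eventually_gt_at_top[of 0] by eventually_elim (simp add: contribution_def)
  ultimately show ?thesis by (rule Lim_transform_eventually)
qed

text \<open>The limit is taken coefficient by coefficient: finitely many graphs have
  \<open>n\<close> bubbles, and only the terms of degree 0 remain.\<close>

lemma free_energy_tendsto:
  "((\<lambda>N. fps_nth (free_energy D B c N) n / N ^ D) \<longlongrightarrow> fps_nth (order_series D B c 0) n) at_top"
proof -
  let ?S = "{G. G \<in> tildeG D B \<and> num_bubbles G = n}"
  have "((\<lambda>N. \<Sum>G\<in>?S. contribution D B c N G / N ^ D) \<longlongrightarrow>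
      (\<Sum>G\<in>?S. if delta D (alphaM D B) G = 0 then c G else 0)) at_top"
    by (intro tendsto_sum contribution_tendsto) simp
  moreover have "(\<Sum>G\<in>?S. if delta D (alphaM D B) G = 0 then c G else 0) =
      fps_nth (order_series D B c 0) n"
  proof -
    have "(\<Sum>G\<in>?S. if delta D (alphaM D B) G = 0 then c G else 0) =
        (\<Sum>G | G \<in> ?S \<and> delta D (alphaM D B) G = 0. c G)"
      using finite_num_bubbles[of D B n] by (intro sum.inter_filter[symmetric]) simp
    also have "{G. G \<in> ?S \<and> delta D (alphaM D B) G = 0} =
        {G. G \<in> order_contributions D B (alphaM D B) 0 \<and> num_bubbles G = n}"
      unfolding order_contributions_def by auto
    finally show ?thesis by (simp add: order_series_def)
  qed
  ultimately show ?thesis by (simp add: free_energy_def sum_divide_distrib)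
qed

section \<open>Rationality and conclusion\<close>

text \<open>A maximizer exhibits \<open>alphaM D B\<close> as a quotient of integers, which makes
  the degree of every graph rational.\<close>

lemma nonneg_rational_alphaM:
  assumes "G \<in> tildeG D B" "(real (Phi0 D G) - real D) / real (num_bubbles G) = alphaM D B"
  shows "nonneg_rational D B (alphaM D B)"
proof -
  have "alphaM D B \<in> \<rat>" unfolding assms(2)[symmetric] by (intro Rats_divide Rats_diff Rats_of_nat)
  then have "delta D (alphaM D B) K \<in> \<rat>" for K
    unfolding delta_def by (intro Rats_diff Rats_add Rats_mult Rats_of_nat)
  then show ?thesis unfolding nonneg_rational_def using delta_alphaM_nonneg by blast
qed

theorem theorem3p2p2:
  fixes B :: "'v cgraph" and D :: nat
  assumes "1 \<le> D" and "bubble D B"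
  shows "(\<forall>a. nonneg_rational D B a \<and> nontrivial D B a \<longrightarrow> a = alphaM D B) \<and>
    ((\<exists>G \<in> tildeG D B. (real (Phi0 D G) - real D) / real (num_bubbles G) = alphaM D B) \<longrightarrow>
      nontrivial D B (alphaM D B) \<and>
      nonneg_rational D B (alphaM D B) \<and>
      infinite {G \<in> tildeG D B.
        real D + alphaM D B * real (num_bubbles G) - real (Phi0 D G) = 0} \<and>
      leading_order D B (alphaM D B) 0 \<and>
      (\<forall>c :: nat cgraph \<Rightarrow> real. (\<forall>G \<in> tildeG D B. c G \<noteq> 0) \<longrightarrow>
        (\<forall>G \<in> order_contributions D B (alphaM D B) 0.
          ((\<lambda>N. contribution D B c N G / N ^ D) \<longlongrightarrow> c G) at_top) \<and>
        (\<forall>G \<in> tildeG D B - order_contributions D B (alphaM D B) 0.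
          ((\<lambda>N. contribution D B c N G / N ^ D) \<longlongrightarrow> 0) at_top) \<and>
        (\<forall>n. ((\<lambda>N. fps_nth (free_energy D B c N) n / N ^ D)
          \<longlongrightarrow> fps_nth (order_series D B c 0) n) at_top)))"
proof (intro conjI impI allI)
  fix a assume "nonneg_rational D B a \<and> nontrivial D B a"
  then show "a = alphaM D B" using nonneg_nontrivial_eq_alphaM[OF assms] by blast
next
  assume "\<exists>G \<in> tildeG D B. (real (Phi0 D G) - real D) / real (num_bubbles G) = alphaM D B"
  then obtain G where G: "G \<in> tildeG D B"
    and max: "(real (Phi0 D G) - real D) / real (num_bubbles G) = alphaM D B" by blast
  \<comment> \<open>Positivity allows the denominator to be cleared, so attaining the supremum means
    degree 0.\<close>
  have "0 < num_bubbles G" using num_bubbles_pos G tildeG_subset by blast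
  then have "delta D (alphaM D B) G = 0"
    unfolding max[symmetric] by (simp add: delta_def)
  then have inf: "infinite (order_contributions D B (alphaM D B) 0)"
    by (rule infinite_order_zero[OF assms G])
  then show "nontrivial D B (alphaM D B)" unfolding nontrivial_def by blast
  show "infinite {G \<in> tildeG D B.
      real D + alphaM D B * real (num_bubbles G) - real (Phi0 D G) = 0}"
    using inf unfolding order_contributions_def delta_def .
  show "leading_order D B (alphaM D B) 0"
    unfolding leading_order_def
  proof (intro conjI allI impI)
    show "order_contributions D B (alphaM D B) 0 \<noteq> {}" using inf by auto
    fix k :: real assume "k < 0"
    then show "order_contributions D B (alphaM D B) k = {}"
      using delta_alphaM_nonneg unfolding order_contributions_def by fastforce
  qed
  show "nonneg_rational D B (alphaM D B)" using G max by (rule nonneg_rational_alphaM)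
  fix c :: "nat cgraph \<Rightarrow> real"
  show "\<forall>G \<in> order_contributions D B (alphaM D B) 0.
      ((\<lambda>N. contribution D B c N G / N ^ D) \<longlongrightarrow> c G) at_top"
    using contribution_tendsto[of _ D B c] unfolding order_contributions_def by fastforce
  show "\<forall>G \<in> tildeG D B - order_contributions D B (alphaM D B) 0.
      ((\<lambda>N. contribution D B c N G / N ^ D) \<longlongrightarrow> 0) at_top"
  proof
    fix G assume "G \<in> tildeG D B - order_contributions D B (alphaM D B) 0"
    then show "((\<lambda>N. contribution D B c N G / N ^ D) \<longlongrightarrow> 0) at_top"
      using contribution_tendsto[of G D B c] by (simp add: order_contributions_def)
  qed
  show "((\<lambda>N. fps_nth (free_energy D B c N) n / N ^ D)
      \<longlongrightarrow> fps_nth (order_series D B c 0) n) at_top" for n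
    by (rule free_energy_tendsto)
qed

end
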